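(* Let $(L, [\cdot ,\cdot ], \alpha , \beta )$ be a left (respectively right) BiHom-Lie algebra over a field $\Bbbk$ and let $R:L\rightarrow L$ be a Rota-Baxter operator of weight $0$ for $(L,[\cdot,\cdot])$ such that $R\circ \alpha =\alpha \circ R$ and $R\circ \beta =\beta \circ R$. Define a new operation on $L$ by $x\cdot y:=[R(x), y]$ (respectively by $x\cdot y:=[x, R(y)]$), for all $x, y\in L$. Then $(L, \cdot , \alpha , \beta )$ is a left (respectively right) BiHom-pre-Lie algebra.
   Context: All linear spaces and (bi)linear maps are over a base field $\Bbbk$. A left (respectively right) BiHom-Leibniz algebra is a 4-tuple $(L, [\cdot ,\cdot ], \alpha , \beta )$, where $L$ is a linear space, $[\cdot , \cdot ]:L\times L\rightarrow L$ is a bilinear map and $\alpha , \beta :L\rightarrow L$ are linear maps satisfying $\alpha \circ \beta =\beta \circ \alpha $, $\alpha ([x, y])=[\alpha (x), \alpha (y)]$, $\beta ([x, y])=[\beta (x), \beta (y)]$ and $$[\alpha \beta (x), [y, z]]=[[\beta (x), y], \beta (z)]+[\beta (y), [\alpha (x), z]],$$ respectively $$[[x, y], \alpha \beta (z)]=[[x, \beta (z)], \alpha (y)]+[\alpha (x), [y, \alpha (z)]],$$ for all $x, y, z\in L$ (here $\alpha\beta=\alpha\circ\beta$). A left (respectively right) BiHom-Lie algebra is a left (respectively right) BiHom-Leibniz algebra satisfying the BiHom-skew-symmetry condition $[\beta (x), \alpha (y)]=-[\beta (y), \alpha (x)]$ for all $x,y\in L$. A Rota-Baxter operator of weight $\lambda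 \in \Bbbk$ for a linear space $A$ with bilinear multiplication $(x,y)\mapsto xy$ is a linear map $R:A\to A$ with $R(x)R(y)=R(R(x)y+xR(y)+\lambda xy)$ for all $x,y\in A$. Here the multiplication is the bracket. A left (respectively right) BiHom-pre-Lie algebra $(A, \cdot , \alpha , \beta )$ is a linear space $A$ with a bilinear operation $\cdot$ and linear maps $\alpha , \beta :A\rightarrow A$ satisfying $\alpha \circ \beta =\beta \circ \alpha $, $\alpha (x\cdot y)=\alpha (x)\cdot \alpha (y)$, $\beta (x\cdot y)=\beta (x)\cdot \beta (y)$ and $$\alpha \beta (x)\cdot (\alpha (y)\cdot z)-(\beta (x)\cdot \alpha (y))\cdot \beta (z)=\alpha \beta (y)\cdot (\alpha (x)\cdot z)-(\beta (y)\cdot \alpha (x))\cdot \beta (z),$$ respectively $$\alpha (x)\cdot (\beta (y)\cdot \alpha (z))-(x\cdot \beta (y))\cdot \alpha \beta (z)=\alpha (x)\cdot (\beta (z)\cdot \alpha (y))-(x\cdot \beta (z))\cdot \alpha \beta (y),$$ for all $x, y, z\in A$. *)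

theory Defs
  imports Complex_Main
begin

text \<open>
  A linear space over a field is a type of class \<open>ab_group_add\<close> together with a scalar
  multiplication satisfying \<^locale>\<open>vector_space\<close>.
\<close>

locale bilinear_algebra = vector_space scale
  for scale :: "'k::field \<Rightarrow> 'v::ab_group_add \<Rightarrow> 'v" +
  fixes mult :: "'v \<Rightarrow> 'v \<Rightarrow> 'v"
  assumes linear_mult_left: "Vector_Spaces.linear scale scale (\<lambda>x. mult x y)"
    and linear_mult_right: "Vector_Spaces.linear scale scale (\<lambda>y. mult x y)"

locale bihom_algebra = bilinear_algebra scale mult
  for scale :: "'k::field \<Rightarrow> 'v::ab_group_add \<Rightarrow> 'v"
    and mult :: "'v \<Rightarrow> 'v \<Rightarrow> 'v" +
  fixes \<alpha> \<beta> :: "'v \<Rightarrow> 'v"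
  assumes linear_alpha: "Vector_Spaces.linear scale scale \<alpha>"
    and linear_beta: "Vector_Spaces.linear scale scale \<beta>"
    and alpha_beta_commute: "\<alpha> \<circ> \<beta> = \<beta> \<circ> \<alpha>"
    and alpha_mult: "\<alpha> (mult x y) = mult (\<alpha> x) (\<alpha> y)"
    and beta_mult: "\<beta> (mult x y) = mult (\<beta> x) (\<beta> y)"

locale left_bihom_leibniz = bihom_algebra scale br \<alpha> \<beta>
  for scale :: "'k::field \<Rightarrow> 'v::ab_group_add \<Rightarrow> 'v"
    and br :: "'v \<Rightarrow> 'v \<Rightarrow> 'v" and \<alpha> \<beta> :: "'v \<Rightarrow> 'v" +
  assumes left_leibniz:
    "br (\<alpha> (\<beta> x)) (br y z) = br (br (\<beta> x) y) (\<beta> z) + br (\<beta> y) (br (\<alpha> x) z)"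

locale right_bihom_leibniz = bihom_algebra scale br \<alpha> \<beta>
  for scale :: "'k::field \<Rightarrow> 'v::ab_group_add \<Rightarrow> 'v"
    and br :: "'v \<Rightarrow> 'v \<Rightarrow> 'v" and \<alpha> \<beta> :: "'v \<Rightarrow> 'v" +
  assumes right_leibniz:
    "br (br x y) (\<alpha> (\<beta> z)) = br (br x (\<beta> z)) (\<alpha> y) + br (\<alpha> x) (br y (\<alpha> z))"

locale left_bihom_lie = left_bihom_leibniz scale br \<alpha> \<beta>
  for scale :: "'k::field \<Rightarrow> 'v::ab_group_add \<Rightarrow> 'v"
    and br :: "'v \<Rightarrow> 'v \<Rightarrow> 'v" and \<alpha> \<beta> :: "'v \<Rightarrow> 'v" +
  assumes bihom_skew_symmetry: "br (\<beta> x) (\<alpha> y) = - br (\<beta> y) (\<alpha> x)"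

locale right_bihom_lie = right_bihom_leibniz scale br \<alpha> \<beta>
  for scale :: "'k::field \<Rightarrow> 'v::ab_group_add \<Rightarrow> 'v"
    and br :: "'v \<Rightarrow> 'v \<Rightarrow> 'v" and \<alpha> \<beta> :: "'v \<Rightarrow> 'v" +
  assumes bihom_skew_symmetry: "br (\<beta> x) (\<alpha> y) = - br (\<beta> y) (\<alpha> x)"

locale rota_baxter_operator = bilinear_algebra scale mult
  for scale :: "'k::field \<Rightarrow> 'v::ab_group_add \<Rightarrow> 'v"
    and mult :: "'v \<Rightarrow> 'v \<Rightarrow> 'v" +
  fixes weight :: 'k and R :: "'v \<Rightarrow> 'v"
  assumes linear_R: "Vector_Spaces.linear scale scale R"
    and rota_baxter:
      "mult (R x) (R y) = R (mult (R x) y + mult x (R y) + scale weight (mult x y))"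

locale left_bihom_pre_lie = bihom_algebra scale mult \<alpha> \<beta>
  for scale :: "'k::field \<Rightarrow> 'v::ab_group_add \<Rightarrow> 'v"
    and mult :: "'v \<Rightarrow> 'v \<Rightarrow> 'v" and \<alpha> \<beta> :: "'v \<Rightarrow> 'v" +
  assumes left_pre_lie:
    "mult (\<alpha> (\<beta> x)) (mult (\<alpha> y) z) - mult (mult (\<beta> x) (\<alpha> y)) (\<beta> z)
      = mult (\<alpha> (\<beta> y)) (mult (\<alpha> x) z) - mult (mult (\<beta> y) (\<alpha> x)) (\<beta> z)"

locale right_bihom_pre_lie = bihom_algebra scale mult \<alpha> \<beta>
  for scale :: "'k::field \<Rightarrow> 'v::ab_group_add \<Rightarrow> 'v"
    and mult :: "'v \<Rightarrow> 'v \<Rightarrow> 'v" and \<alpha> \<beta> :: "'v \<Rightarrow> 'v" +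
  assumes right_pre_lie:
    "mult (\<alpha> x) (mult (\<beta> y) (\<alpha> z)) - mult (mult x (\<beta> y)) (\<alpha> (\<beta> z))
      = mult (\<alpha> x) (mult (\<beta> z) (\<alpha> y)) - mult (mult x (\<beta> z)) (\<alpha> (\<beta> y))"

end

theory Submission
  imports Defs
begin

text \<open>
  The pre-Lie identity says that the associator of the new product is symmetric in two of its
  arguments. In the left case, applying the Leibniz identity to \<open>R x\<close>, \<open>\<alpha> (R y)\<close>, \<open>z\<close> produces
  both iterated products of the pre-Lie identity, and their difference is
  \<open>[[\<beta> (R x), \<alpha> (R y)], \<beta> z]\<close>. The Rota-Baxter identity
  moves one \<open>R\<close> out of the inner bracket, at the price of two summands. In one of them \<open>R\<close> sits on
  the wrong argument for it to be a new product, and BiHom-skew-symmetry exchanges the arguments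
  there. The two summands are then \<open>R\<close> of the products \<open>\<beta> x \<cdot> \<alpha> y\<close> and
  \<open>- (\<beta> y \<cdot> \<alpha> x)\<close>, which are the two remaining terms. In the right case the
  Leibniz identity for \<open>x\<close>, \<open>R y\<close>, \<open>R z\<close> plays the same role.

  Both cases thus rest on the Rota-Baxter identity antisymmetrised in the BiHom sense
  (\<open>rota_baxter_skew_left\<close>, \<open>rota_baxter_skew_right\<close>). The twisted products
  satisfy the remaining axioms because \<open>R\<close> is linear and commutes with the structure maps.
\<close>

lemma bihom_algebra_twist:
  assumes "bihom_algebra scale mult \<alpha> \<beta>"
    and linear_R: "Vector_Spaces.linear scale scale R"
    and R_alpha: "\<And>x. R (\<alpha> x) = \<alpha> (R x)"
    and R_beta: "\<And>x. R (\<beta> x) = \<beta> (R x)"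
  shows bihom_algebra_twist_left: "bihom_algebra scale (\<lambda>x y. mult (R x) y) \<alpha> \<beta>"
    and bihom_algebra_twist_right: "bihom_algebra scale (\<lambda>x y. mult x (R y)) \<alpha> \<beta>"
proof -
  interpret bihom_algebra scale mult \<alpha> \<beta> by fact
  have left: "Vector_Spaces.linear scale scale (\<lambda>x. mult (R x) y)" for y
    using Vector_Spaces.linear_compose[OF linear_R linear_mult_left[of y]] by (simp add: comp_def)
  have right: "Vector_Spaces.linear scale scale (\<lambda>y. mult x (R y))" for x
    using Vector_Spaces.linear_compose[OF linear_R linear_mult_right[of x]] by (simp add: comp_def)
  show "bihom_algebra scale (\<lambda>x y. mult (R x) y) \<alpha> \<beta>"
    by (intro bihom_algebra.intro bilinear_algebra.intro bilinear_algebra_axioms.intro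
          bihom_algebra_axioms.intro vector_space_axioms left linear_mult_right
          linear_alpha linear_beta alpha_beta_commute)
      (simp_all only: alpha_mult beta_mult R_alpha R_beta)
  show "bihom_algebra scale (\<lambda>x y. mult x (R y)) \<alpha> \<beta>"
    by (intro bihom_algebra.intro bilinear_algebra.intro bilinear_algebra_axioms.intro
          bihom_algebra_axioms.intro vector_space_axioms linear_mult_left right
          linear_alpha linear_beta alpha_beta_commute)
      (simp_all only: alpha_mult beta_mult R_alpha R_beta)
qed

context bilinear_algebra
begin

lemma mult_diff_left: "mult (x - y) z = mult x z - mult y z"
proof -
  interpret l: Vector_Spaces.linear scale scale "\<lambda>x. mult x z" by (rule linear_mult_left)
  show ?thesis by (rule l.diff)
qed

lemma mult_diff_right: "mult x (y - z) = mult x y - mult x z"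
proof -
  interpret l: Vector_Spaces.linear scale scale "\<lambda>y. mult x y" by (rule linear_mult_right)
  show ?thesis by (rule l.diff)
qed

end

text \<open>
  Of the two summands \<open>[R (\<beta> x), \<alpha> y]\<close> and \<open>[\<beta> x, R (\<alpha> y)]\<close> in the Rota-Baxter identity for
  \<open>\<beta> x\<close> and \<open>\<alpha> y\<close>, BiHom-skew-symmetry turns either one into the negative of the other with
  \<open>x\<close> and \<open>y\<close> exchanged; it applies because \<open>R\<close> can be moved inside \<open>\<alpha>\<close> and \<open>\<beta>\<close>. The two versions
  keep \<open>R\<close> on the left and on the right argument respectively, as the two products require.
\<close>

lemma rota_baxter_skew:
  assumes "rota_baxter_operator scale br 0 R"
    and R_alpha: "\<And>x. R (\<alpha> x) = \<alpha> (R x)"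
    and R_beta: "\<And>x. R (\<beta> x) = \<beta> (R x)"
    and skew: "\<And>x y. br (\<beta> x) (\<alpha> y) = - br (\<beta> y) (\<alpha> x)"
  shows rota_baxter_skew_left:
      "br (\<beta> (R x)) (\<alpha> (R y)) = R (br (\<beta> (R x)) (\<alpha> y)) - R (br (\<beta> (R y)) (\<alpha> x))"
    and rota_baxter_skew_right:
      "br (\<beta> (R x)) (\<alpha> (R y)) = R (br (\<beta> x) (\<alpha> (R y))) - R (br (\<beta> y) (\<alpha> (R x)))"
proof -
  interpret rota_baxter_operator scale br 0 R by fact
  interpret R: Vector_Spaces.linear scale scale R by (rule linear_R)
  have rb: "br (\<beta> (R x)) (\<alpha> (R y)) = R (br (\<beta> (R x)) (\<alpha> y)) + R (br (\<beta> x) (\<alpha> (R y)))"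
    using rota_baxter[of "\<beta> x" "\<alpha> y"] by (simp add: R_alpha R_beta R.add)
  show "br (\<beta> (R x)) (\<alpha> (R y)) = R (br (\<beta> (R x)) (\<alpha> y)) - R (br (\<beta> (R y)) (\<alpha> x))"
    using rb by (simp add: skew[of x "R y"] R.neg)
  show "br (\<beta> (R x)) (\<alpha> (R y)) = R (br (\<beta> x) (\<alpha> (R y))) - R (br (\<beta> y) (\<alpha> (R x)))"
    using rb by (simp add: skew[of "R x" y] R.neg)
qed

lemma left_bihom_pre_lie_of_rota_baxter:
  assumes "left_bihom_lie scale br \<alpha> \<beta>"
    and rb: "rota_baxter_operator scale br 0 R"
    and R_alpha: "\<And>x. R (\<alpha> x) = \<alpha> (R x)"
    and R_beta: "\<And>x. R (\<beta> x) = \<beta> (R x)"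
  shows "left_bihom_pre_lie scale (\<lambda>x y. br (R x) y) \<alpha> \<beta>"
proof -
  interpret left_bihom_lie scale br \<alpha> \<beta> by fact
  have "br (R (\<alpha> (\<beta> x))) (br (R (\<alpha> y)) z) - br (R (br (R (\<beta> x)) (\<alpha> y))) (\<beta> z)
      = br (R (\<alpha> (\<beta> y))) (br (R (\<alpha> x)) z) - br (R (br (R (\<beta> y)) (\<alpha> x))) (\<beta> z)" for x y z
  proof -
    have "br (\<alpha> (\<beta> (R x))) (br (\<alpha> (R y)) z)
        = br (br (\<beta> (R x)) (\<alpha> (R y))) (\<beta> z) + br (\<alpha> (\<beta> (R y))) (br (\<alpha> (R x)) z)"
      using left_leibniz[of "R x" "\<alpha> (R y)" z] fun_cong[OF alpha_beta_commute, of "R y"]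
      by simp
    also have "br (br (\<beta> (R x)) (\<alpha> (R y))) (\<beta> z)
        = br (R (br (\<beta> (R x)) (\<alpha> y))) (\<beta> z) - br (R (br (\<beta> (R y)) (\<alpha> x))) (\<beta> z)"
      by (simp add: rota_baxter_skew_left[where R = R and \<alpha> = \<alpha> and \<beta> = \<beta>,
            OF rb R_alpha R_beta bihom_skew_symmetry] mult_diff_left)
    finally show ?thesis by (simp add: R_alpha R_beta algebra_simps)
  qed
  moreover have "bihom_algebra scale (\<lambda>x y. br (R x) y) \<alpha> \<beta>"
    by (rule bihom_algebra_twist_left[OF bihom_algebra_axioms
          rota_baxter_operator.linear_R[OF rb] R_alpha R_beta])
  ultimately show ?thesis
    by (simp add: left_bihom_pre_lie_def left_bihom_pre_lie_axioms_def)
qed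

lemma right_bihom_pre_lie_of_rota_baxter:
  assumes "right_bihom_lie scale br \<alpha> \<beta>"
    and rb: "rota_baxter_operator scale br 0 R"
    and R_alpha: "\<And>x. R (\<alpha> x) = \<alpha> (R x)"
    and R_beta: "\<And>x. R (\<beta> x) = \<beta> (R x)"
  shows "right_bihom_pre_lie scale (\<lambda>x y. br x (R y)) \<alpha> \<beta>"
proof -
  interpret right_bihom_lie scale br \<alpha> \<beta> by fact
  have "br (\<alpha> x) (R (br (\<beta> y) (R (\<alpha> z)))) - br (br x (R (\<beta> y))) (R (\<alpha> (\<beta> z)))
      = br (\<alpha> x) (R (br (\<beta> z) (R (\<alpha> y)))) - br (br x (R (\<beta> z))) (R (\<alpha> (\<beta> y)))" for x y z
  proof -
    have "br (br x (\<beta> (R y))) (\<alpha> (\<beta> (R z)))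
        = br (br x (\<beta> (R z))) (\<alpha> (\<beta> (R y))) + br (\<alpha> x) (br (\<beta> (R y)) (\<alpha> (R z)))"
      by (rule right_leibniz)
    also have "br (\<alpha> x) (br (\<beta> (R y)) (\<alpha> (R z)))
        = br (\<alpha> x) (R (br (\<beta> y) (\<alpha> (R z)))) - br (\<alpha> x) (R (br (\<beta> z) (\<alpha> (R y))))"
      by (simp add: rota_baxter_skew_right[where R = R and \<alpha> = \<alpha> and \<beta> = \<beta>,
            OF rb R_alpha R_beta bihom_skew_symmetry]
          mult_diff_right)
    finally show ?thesis by (simp add: R_alpha R_beta algebra_simps)
  qed
  moreover have "bihom_algebra scale (\<lambda>x y. br x (R y)) \<alpha> \<beta>"
    by (rule bihom_algebra_twist_right[OF bihom_algebra_axioms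
          rota_baxter_operator.linear_R[OF rb] R_alpha R_beta])
  ultimately show ?thesis
    by (simp add: right_bihom_pre_lie_def right_bihom_pre_lie_axioms_def)
qed

theorem proposition4p11:
  fixes scale :: "'k::field \<Rightarrow> 'v::ab_group_add \<Rightarrow> 'v"
    and br :: "'v \<Rightarrow> 'v \<Rightarrow> 'v"
    and \<alpha> \<beta> R :: "'v \<Rightarrow> 'v"
  assumes "rota_baxter_operator scale br 0 R"
    and "R \<circ> \<alpha> = \<alpha> \<circ> R"
    and "R \<circ> \<beta> = \<beta> \<circ> R"
  shows "(left_bihom_lie scale br \<alpha> \<beta> \<longrightarrow>
            left_bihom_pre_lie scale (\<lambda>x y. br (R x) y) \<alpha> \<beta>) \<and>
         (right_bihom_lie scale br \<alpha> \<beta> \<longrightarrow>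
            right_bihom_pre_lie scale (\<lambda>x y. br x (R y)) \<alpha> \<beta>)"
proof -
  have R_alpha: "R (\<alpha> x) = \<alpha> (R x)" and R_beta: "R (\<beta> x) = \<beta> (R x)" for x
    using fun_cong[OF assms(2), of x] fun_cong[OF assms(3), of x] by simp_all
  show ?thesis
    using left_bihom_pre_lie_of_rota_baxter[where R = R and \<alpha> = \<alpha> and \<beta> = \<beta>, OF _ assms(1) R_alpha R_beta]
      right_bihom_pre_lie_of_rota_baxter[where R = R and \<alpha> = \<alpha> and \<beta> = \<beta>, OF _ assms(1) R_alpha R_beta]
    by blast
qed

end
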